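(* Let $P:\mathbb{R}^d\to\mathbb{C}$ be a positive homogeneous polynomial. Then for any $E,E'\in\mathrm{Exp}(P)$, $$\operatorname{tr}(E)=\operatorname{tr}(E').$$
   Context: For $E\in M_d(\mathbb{R})$ and $t>0$, $t^E=\exp((\log t)E)$. For a continuous $P:\mathbb{R}^d\to\mathbb{C}$, $\mathrm{Exp}(P)$ is the set of $E\in M_d(\mathbb{R})$ with $tP(\xi)=P(t^E\xi)$ for all $t>0$, $\xi\in\mathbb{R}^d$. $P$ is positive homogeneous if $R=\operatorname{Re}P$ is positive definite ($R(\xi)\ge 0$, with $R(\xi)=0$ only when $\xi=0$) and $\mathrm{Exp}(P)$ contains a matrix with real spectrum. Polynomials have complex coefficients and $d$ real variables. *)

theory Defs
  imports "HOL-Analysis.Analysis"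
begin

text \<open>The product and power inherited by \<open>real ^ 'n ^ 'n\<close> from its type class instances are
  componentwise, and the type is not a normed algebra, so the library's \<open>exp\<close> does not apply;
  the exponential series is written here with the matrix product.\<close>

definition mat_power :: "real ^ 'n ^ 'n \<Rightarrow> nat \<Rightarrow> real ^ 'n ^ 'n"
  where "mat_power A k = (((**) A) ^^ k) (mat 1)"

definition mat_exp :: "real ^ 'n ^ 'n \<Rightarrow> real ^ 'n ^ 'n"
  where "mat_exp A = (\<Sum>k. (1 / fact k) *\<^sub>R mat_power A k)"

lemma norm_matrix_mult_le:
  fixes A B :: "real ^ 'n ^ 'n"
  shows "norm (A ** B) \<le> norm A * norm B"
proof -
  have cauchy: "\<bar>(A ** B) $ i $ j\<bar> \<le> norm (A $ i) * norm (column j B)" for i j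
  proof -
    have "(A ** B) $ i $ j = inner (A $ i) (column j B)"
      by (simp add: matrix_matrix_mult_def column_def inner_vec_def)
    then show ?thesis by (simp add: Cauchy_Schwarz_ineq2)
  qed
  have sq: "(norm C)\<^sup>2 = (\<Sum>i\<in>UNIV. \<Sum>j\<in>UNIV. (C $ i $ j)\<^sup>2)" for C :: "real ^ 'n ^ 'n"
    by (simp add: norm_vec_def L2_set_def sum_nonneg)
  have "(norm (A ** B))\<^sup>2 \<le> (\<Sum>i\<in>UNIV. \<Sum>j\<in>UNIV. (norm (A $ i))\<^sup>2 * (norm (column j B))\<^sup>2)"
    unfolding sq
    by (intro sum_mono) (metis cauchy abs_ge_zero power2_abs power_mono power_mult_distrib)
  also have "\<dots> = (\<Sum>i\<in>UNIV. (norm (A $ i))\<^sup>2) * (\<Sum>j\<in>UNIV. (norm (column j B))\<^sup>2)"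
    by (simp add: sum_product)
  also have "(\<Sum>i\<in>UNIV. (norm (A $ i))\<^sup>2) = (norm A)\<^sup>2"
    by (simp add: norm_vec_def L2_set_def sum_nonneg)
  also have "(\<Sum>j\<in>UNIV. (norm (column j B))\<^sup>2) = (norm B)\<^sup>2"
    unfolding sq by (subst sum.swap) (simp add: norm_vec_def L2_set_def sum_nonneg column_def)
  finally show ?thesis
    by (metis mult_nonneg_nonneg norm_ge_zero power2_le_imp_le power_mult_distrib)
qed

lemma summable_mat_exp:
  fixes A :: "real ^ 'n ^ 'n"
  shows "summable (\<lambda>k. (1 / fact k) *\<^sub>R mat_power A k)"
proof (rule summable_comparison_test')
  have "norm (mat_power A k) \<le> norm (mat 1 :: real ^ 'n ^ 'n) * norm A ^ k" for k
  proof (induction k)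
    case (Suc k)
    have "norm (mat_power A (Suc k)) \<le> norm A * norm (mat_power A k)"
      by (simp add: mat_power_def norm_matrix_mult_le)
    also have "\<dots> \<le> norm A * (norm (mat 1 :: real ^ 'n ^ 'n) * norm A ^ k)"
      by (intro mult_left_mono Suc.IH) simp
    finally show ?case by (simp add: mult_ac)
  qed (simp add: mat_power_def)
  then show "norm ((1 / fact k) *\<^sub>R mat_power A k)
      \<le> norm (mat 1 :: real ^ 'n ^ 'n) * (inverse (fact k) * norm A ^ k)" for k
    by (simp add: field_simps divide_right_mono)
  show "summable (\<lambda>k. norm (mat 1 :: real ^ 'n ^ 'n) * (inverse (fact k) * norm A ^ k))"
    by (intro summable_mult summable_exp)
qed

definition mat_powr :: "real \<Rightarrow> real ^ 'n ^ 'n \<Rightarrow> real ^ 'n ^ 'n"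
  where "mat_powr t E = mat_exp (ln t *\<^sub>R E)"

definition Exp_set :: "(real ^ 'n \<Rightarrow> complex) \<Rightarrow> (real ^ 'n ^ 'n) set"
  where "Exp_set P = {E. \<forall>t>0. \<forall>\<xi>. complex_of_real t * P \<xi> = P (mat_powr t E *v \<xi>)}"

definition spectrum :: "complex ^ 'n ^ 'n \<Rightarrow> complex set"
  where "spectrum A = {\<mu>. \<exists>v. v \<noteq> 0 \<and> A *v v = \<mu> *s v}"

text \<open>The spectrum of a real matrix is that of its complexification, so that
  having real spectrum excludes non-real eigenvalues.\<close>

definition real_spectrum :: "real ^ 'n ^ 'n \<Rightarrow> bool"
  where "real_spectrum E \<longleftrightarrow> spectrum (map_matrix complex_of_real E) \<subseteq> \<real>"

definition positive_homogeneous :: "(real ^ 'n \<Rightarrow> complex) \<Rightarrow> bool"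
  where "positive_homogeneous P \<longleftrightarrow>
    continuous_on UNIV P \<and>
    (\<forall>\<xi>. Re (P \<xi>) \<ge> 0) \<and> (\<forall>\<xi>. Re (P \<xi>) = 0 \<longrightarrow> \<xi> = 0) \<and>
    (\<exists>E\<in>Exp_set P. real_spectrum E)"

text \<open>For complex-valued functions on \<open>real ^ 'n\<close>, the library's \<open>polynomial_function\<close>
  (defined through real linear functionals) means polynomial in the coordinates with
  complex coefficients.\<close>

lemma polynomial_function_complex_iff:
  fixes P :: "real ^ 'n \<Rightarrow> complex"
  shows "polynomial_function P \<longleftrightarrow>
    (\<exists>(A :: ('n \<Rightarrow> nat) set) c. finite A \<and>
      P = (\<lambda>\<xi>. \<Sum>\<alpha>\<in>A. c \<alpha> * (\<Prod>i\<in>UNIV. complex_of_real (\<xi> $ i) ^ \<alpha> i)))"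
    (is "_ \<longleftrightarrow> ?cp P")
proof
  define mon where "mon \<alpha> \<xi> = (\<Prod>i\<in>UNIV. complex_of_real (\<xi> $ i) ^ \<alpha> i)"
    for \<alpha> :: "'n \<Rightarrow> nat" and \<xi> :: "real ^ 'n"
  define cp where "cp f \<longleftrightarrow> (\<exists>(A :: ('n \<Rightarrow> nat) set) c. finite A \<and>
      f = (\<lambda>\<xi>. \<Sum>\<alpha>\<in>A. c \<alpha> * mon \<alpha> \<xi>))" for f
  have cpI: "cp (\<lambda>\<xi>. k * mon \<alpha> \<xi>)" for k \<alpha>
    unfolding cp_def by (rule exI[of _ "{\<alpha>}"], rule exI[of _ "\<lambda>_. k"]) simp
  have cp_const: "cp (\<lambda>_. k)" for k
    using cpI[of k "\<lambda>_. 0"] by (simp add: mon_def)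
  have cp_coord: "cp (\<lambda>\<xi>. complex_of_real (\<xi> $ j))" for j
  proof -
    have "mon (\<lambda>i. if i = j then 1 else 0) \<xi> = complex_of_real (\<xi> $ j)" for \<xi>
      unfolding mon_def by (subst prod.remove[of _ j]) auto
    then show ?thesis using cpI[of 1 "\<lambda>i. if i = j then 1 else 0"] by simp
  qed
  have cp_add: "cp (\<lambda>\<xi>. f \<xi> + g \<xi>)" if cpf: "cp f" and cpg: "cp g" for f g
  proof -
    obtain A c where A: "finite A" and f: "f = (\<lambda>\<xi>. \<Sum>\<alpha>\<in>A. c \<alpha> * mon \<alpha> \<xi>)"
      using cpf[unfolded cp_def] by (elim exE conjE) (rule that)
    obtain B d where B: "finite B" and g: "g = (\<lambda>\<xi>. \<Sum>\<alpha>\<in>B. d \<alpha> * mon \<alpha> \<xi>)"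
      using cpg[unfolded cp_def] by (elim exE conjE) (rule that)
    note fin = A B
    let ?c = "\<lambda>\<alpha>. (if \<alpha> \<in> A then c \<alpha> else 0)" and ?d = "\<lambda>\<alpha>. (if \<alpha> \<in> B then d \<alpha> else 0)"
    have "f \<xi> = (\<Sum>\<alpha>\<in>A \<union> B. ?c \<alpha> * mon \<alpha> \<xi>)" for \<xi>
      unfolding f by (rule sum.mono_neutral_cong_left) (use fin in auto)
    moreover have "g \<xi> = (\<Sum>\<alpha>\<in>A \<union> B. ?d \<alpha> * mon \<alpha> \<xi>)" for \<xi>
      unfolding g by (rule sum.mono_neutral_cong_left) (use fin in auto)
    ultimately have "(\<lambda>\<xi>. f \<xi> + g \<xi>) = (\<lambda>\<xi>. \<Sum>\<alpha>\<in>A \<union> B. (?c \<alpha> + ?d \<alpha>) * mon \<alpha> \<xi>)"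
      by (simp add: sum.distrib distrib_right fun_eq_iff)
    then show ?thesis unfolding cp_def using fin
      by (intro exI[of _ "A \<union> B"] exI[of _ "\<lambda>\<alpha>. ?c \<alpha> + ?d \<alpha>"] conjI) auto
  qed
  have cp_sum_pair: "cp (\<lambda>\<xi>. \<Sum>x\<in>X. f x \<xi>)" if "finite X" "\<And>x. x \<in> X \<Longrightarrow> cp (f x)"
    for X :: "(('n \<Rightarrow> nat) \<times> ('n \<Rightarrow> nat)) set" and f
    using that by (induction rule: finite_induct) (auto intro: cp_const cp_add)
  have cp_sum_index: "cp (\<lambda>\<xi>. \<Sum>x\<in>X. f x \<xi>)" if "finite X" "\<And>x. x \<in> X \<Longrightarrow> cp (f x)"
    for X :: "'n set" and f
    using that by (induction rule: finite_induct) (auto intro: cp_const cp_add)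
  have cp_mult: "cp (\<lambda>\<xi>. f \<xi> * g \<xi>)" if cpf: "cp f" and cpg: "cp g" for f g
  proof -
    obtain A c where A: "finite A" and f: "f = (\<lambda>\<xi>. \<Sum>\<alpha>\<in>A. c \<alpha> * mon \<alpha> \<xi>)"
      using cpf[unfolded cp_def] by (elim exE conjE) (rule that)
    obtain B d where B: "finite B" and g: "g = (\<lambda>\<xi>. \<Sum>\<alpha>\<in>B. d \<alpha> * mon \<alpha> \<xi>)"
      using cpg[unfolded cp_def] by (elim exE conjE) (rule that)
    note fin = A B
    have eq: "c \<alpha> * mon \<alpha> \<xi> * (d \<beta> * mon \<beta> \<xi>) = c \<alpha> * d \<beta> * mon (\<lambda>i. \<alpha> i + \<beta> i) \<xi>" for \<alpha> \<beta> \<xi>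
      by (simp add: mon_def power_add prod.distrib mult_ac)
    have "(\<lambda>\<xi>. f \<xi> * g \<xi>) =
        (\<lambda>\<xi>. \<Sum>(\<alpha>, \<beta>)\<in>A \<times> B. c \<alpha> * d \<beta> * mon (\<lambda>i. \<alpha> i + \<beta> i) \<xi>)"
      by (simp only: f g sum_product sum.cartesian_product eq)
    moreover have "cp \<dots>"
      unfolding case_prod_unfold by (rule cp_sum_pair) (use fin in \<open>auto intro: cpI\<close>)
    ultimately show ?thesis by simp
  qed
  have cp_real: "cp (\<lambda>\<xi>. complex_of_real (f \<xi>))" if "real_polynomial_function f" for f
    using that
  proof induction
    case (linear f)
    have rep: "f \<xi> = (\<Sum>j\<in>UNIV. \<xi> $ j * f (axis j 1))" for \<xi>
    proof -
      interpret f: bounded_linear f by fact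
      have "f \<xi> = f (\<Sum>j\<in>UNIV. (\<xi> $ j) *\<^sub>R axis j 1)"
        using basis_expansion[of \<xi>] by (simp add: scalar_mult_eq_scaleR)
      then show ?thesis by (simp add: f.sum f.scaleR)
    qed
    have "(\<lambda>\<xi>. complex_of_real (f \<xi>)) =
        (\<lambda>\<xi>. complex_of_real (\<Sum>j\<in>UNIV. \<xi> $ j * f (axis j 1)))"
      by (rule ext) (rule arg_cong[OF rep])
    also have "\<dots> = (\<lambda>\<xi>. \<Sum>j\<in>UNIV. complex_of_real (\<xi> $ j) * complex_of_real (f (axis j 1)))"
      by (simp only: of_real_sum of_real_mult)
    finally have eq: "(\<lambda>\<xi>. complex_of_real (f \<xi>)) = \<dots>" .
    show ?case
      unfolding eq by (intro cp_sum_index cp_mult cp_coord cp_const finite)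
  qed (auto intro: cp_const cp_add cp_mult)
  show "?cp P" if P: "polynomial_function P"
  proof -
    have "real_polynomial_function (Re \<circ> P)" "real_polynomial_function (Im \<circ> P)"
      using P bounded_linear_Re bounded_linear_Im unfolding polynomial_function_def by blast+
    then have "cp (\<lambda>\<xi>. complex_of_real ((Re \<circ> P) \<xi>) + \<i> * complex_of_real ((Im \<circ> P) \<xi>))"
      by (intro cp_add cp_mult cp_const cp_real)
    then have "cp P" by (simp add: complex_eq[symmetric])
    then show ?thesis by (simp add: cp_def mon_def)
  qed
next
  assume "?cp P"
  then obtain A :: "('n \<Rightarrow> nat) set" and c where A: "finite A"
    and P: "P = (\<lambda>\<xi>. \<Sum>\<alpha>\<in>A. c \<alpha> * (\<Prod>i\<in>UNIV. complex_of_real (\<xi> $ i) ^ \<alpha> i))"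
    by (elim exE conjE) (rule that)
  have real: "real_polynomial_function (\<lambda>\<xi> :: real ^ 'n. \<Prod>i\<in>UNIV. (\<xi> $ i) ^ \<alpha> i)" for \<alpha> :: "'n \<Rightarrow> nat"
    by (intro real_polynomial_function_prod real_polynomial_function_power
        real_polynomial_function.intros(1) bounded_linear_vec_nth finite)
  have "P = (\<lambda>\<xi>. \<Sum>\<alpha>\<in>A. (\<Prod>i\<in>UNIV. (\<xi> $ i) ^ \<alpha> i) *\<^sub>R c \<alpha>)"
    unfolding P by (simp add: scaleR_conv_of_real mult.commute)
  moreover have "polynomial_function \<dots>"
    using A real
    by (intro polynomial_function_sum polynomial_function_mult)
      (auto simp: real_polynomial_function_eq)
  ultimately show "polynomial_function P" by simp
qed

end

theory Submission
  imports Defs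
begin

text \<open>
  Let \<open>R = Re P\<close>. For \<open>E\<close> and \<open>E'\<close> in \<open>Exp(P)\<close> and \<open>t > 0\<close>, the matrices \<open>t\<^sup>E\<close> and
  \<open>t\<^bsup>E'\<^esup>\<close> both multiply \<open>R\<close> by \<open>t\<close>, so \<open>Q = (t\<^bsup>E'\<^esup>)\<^sup>-\<^sup>1 t\<^sup>E\<close> leaves \<open>R\<close> invariant. The
  symmetries of \<open>R\<close> have determinant \<open>\<plusminus>1\<close>: all powers of such a \<open>Q\<close> map the sublevel set
  \<open>{R < m}\<close> into itself, and for small \<open>m\<close> this set is a bounded neighbourhood of \<open>0\<close>, so the powers
  of \<open>Q\<close> are bounded, hence \<open>(det Q)\<^sup>k\<close> is bounded in \<open>k\<close> and \<open>\<bar>det Q\<bar> \<le> 1\<close>; exchanging \<open>E\<close>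
  and \<open>E'\<close> gives the reverse inequality. Therefore \<open>\<bar>det (t\<^sup>E)\<bar> = \<bar>det (t\<^bsup>E'\<^esup>)\<bar>\<close> for every
  \<open>t > 0\<close>, and the traces are recovered as the derivatives of these determinants with respect to
  \<open>ln t\<close> at \<open>t = 1\<close>.

  The essential point is that \<open>{R < m}\<close> is bounded (\<open>positive_definite_sublevel_bounded\<close>); positive
  definiteness and continuity alone do not give this, and it rests on the expansion of space by
  \<open>t\<^sup>E\<close> for large \<open>t\<close>.
\<close>

section \<open>Bounded sublevel sets\<close>

text \<open>For large \<open>t\<close>, the values of \<open>R\<close> on the image of the unit sphere under \<open>A t\<close> exceed the maximum
  of \<open>R\<close> on the unit ball, so \<open>B = A t\<close> maps the sphere outside the closed ball, and by linearity
  \<open>B\<close> expands all lengths by a factor \<open>c > 1\<close>. Pulling a point of norm at least \<open>1\<close> back along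
  \<open>B\<close> thus brings it, after finitely many steps, into a fixed compact annulus, and
  \<open>R\<close> does not increase on the way; so the minimum of \<open>R\<close> on the annulus is a
  lower bound for \<open>R\<close> outside the unit ball.\<close>

lemma positive_definite_sublevel_bounded:
  fixes R :: "real ^ 'n \<Rightarrow> real" and A :: "real \<Rightarrow> real ^ 'n ^ 'n"
  assumes cont: "continuous_on UNIV R"
    and zero: "R 0 = 0" and pos: "\<And>\<xi>. \<xi> \<noteq> 0 \<Longrightarrow> R \<xi> > 0"
    and scale: "\<And>t \<xi>. t > 0 \<Longrightarrow> R (A t *v \<xi>) = t * R \<xi>"
  obtains m where "m > 0" "\<And>\<xi>. R \<xi> < m \<Longrightarrow> norm \<xi> < 1"
proof -
  have cont_on: "continuous_on S R" for S
    using cont continuous_on_subset by blast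
  have nonneg: "R \<xi> \<ge> 0" for \<xi>
    using zero pos by (cases "\<xi> = 0") (auto intro: less_imp_le)
  have unit: "axis undefined 1 \<in> sphere (0 :: real ^ 'n) 1"
    by simp
  then have sphere_ne: "sphere (0 :: real ^ 'n) 1 \<noteq> {}" by blast
  obtain u where u: "u \<in> sphere 0 1" "\<And>\<xi>. \<xi> \<in> sphere 0 1 \<Longrightarrow> R u \<le> R \<xi>"
    using continuous_attains_inf[OF compact_sphere sphere_ne cont_on] by blast
  obtain w where w: "w \<in> cball 0 1" "\<And>\<xi>. \<xi> \<in> cball 0 1 \<Longrightarrow> R \<xi> \<le> R w"
    using continuous_attains_sup[of "cball (0 :: real ^ 'n) 1" R] cont_on by auto
  have Ru: "R u > 0" using u(1) by (intro pos) auto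
  define \<tau> where "\<tau> = R w / R u + 1"
  have \<tau>: "\<tau> \<ge> 1" using Ru nonneg[of w] by (simp add: \<tau>_def)
  define B where "B = A \<tau>"
  have RB: "R (B *v \<xi>) = \<tau> * R \<xi>" for \<xi>
    using scale[of \<tau> \<xi>] \<tau> by (simp add: B_def)
  have B_unit: "norm (B *v \<xi>) > 1" if "norm \<xi> = 1" for \<xi>
  proof (rule ccontr)
    assume "\<not> norm (B *v \<xi>) > 1"
    then have "R (B *v \<xi>) \<le> R w" by (intro w(2)) simp
    moreover have "R w < \<tau> * R u" using Ru by (simp add: \<tau>_def field_simps)
    moreover have "\<tau> * R u \<le> \<tau> * R \<xi>" using u(2)[of \<xi>] that \<tau> by simp
    ultimately show False using RB[of \<xi>] by simp
  qed
  obtain v where v: "v \<in> sphere 0 1" "\<And>\<xi>. \<xi> \<in> sphere 0 1 \<Longrightarrow> norm (B *v v) \<le> norm (B *v \<xi>)"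
  proof -
    have "continuous_on (sphere 0 1) (\<lambda>\<xi>. norm (B *v \<xi>))"
      by (intro continuous_intros)
    from continuous_attains_inf[OF compact_sphere sphere_ne this] show ?thesis
      using that by blast
  qed
  define c where "c = norm (B *v v)"
  have c: "c > 1" using B_unit v(1) by (simp add: c_def)
  have expand: "c * norm \<xi> \<le> norm (B *v \<xi>)" for \<xi>
  proof (cases "\<xi> = 0")
    case False
    have "c \<le> norm (B *v (inverse (norm \<xi>) *\<^sub>R \<xi>))"
      unfolding c_def using False by (intro v(2)) simp
    also have "\<dots> = inverse (norm \<xi>) * norm (B *v \<xi>)"
      by (simp add: matrix_vector_mult_scaleR)
    finally show ?thesis using False by (simp add: field_simps)
  qed simp
  have "\<xi> = 0" if "B *v \<xi> = 0" for \<xi>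
    using expand[of \<xi>] c that by (simp add: mult_le_0_iff)
  then have "inj ((*v) B)"
    by (simp add: linear_injective_0[OF matrix_vector_mul_linear])
  then have surj: "surj ((*v) B)"
    by (rule linear_injective_imp_surjective[OF matrix_vector_mul_linear]) simp
  obtain K where K: "K > 0" "\<And>\<xi>. norm (B *v \<xi>) \<le> norm \<xi> * K"
    using bounded_linear.pos_bounded[OF matrix_vector_mul_bounded_linear, of B] by blast
  \<comment> \<open>Backward orbits cannot jump over this annulus: one step divides the norm by at most \<open>K\<close>.\<close>
  define S where "S = {\<xi> :: real ^ 'n. 1 \<le> norm \<xi> \<and> norm \<xi> \<le> 1 + K}"
  have S: "compact S" "S \<noteq> {}"
  proof -
    have "S = cball 0 (1 + K) - ball 0 1" by (auto simp: S_def)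
    then show "compact S" by (simp add: compact_diff)
    show "S \<noteq> {}" using K(1) unit by (auto simp: S_def intro!: exI[of _ "axis undefined 1"])
  qed
  obtain z where z: "z \<in> S" "\<And>\<xi>. \<xi> \<in> S \<Longrightarrow> R z \<le> R \<xi>"
    using continuous_attains_inf[OF S cont_on] by blast
  have far: "R z \<le> R \<xi>" if "1 \<le> norm \<xi>" "norm \<xi> \<le> c ^ n" for \<xi> n
    using that
  proof (induction n arbitrary: \<xi>)
    case 0
    then show ?case using K(1) by (intro z(2)) (simp add: S_def)
  next
    case (Suc n)
    obtain \<eta> where \<eta>: "\<xi> = B *v \<eta>" using surj by blast
    show ?case
    proof (cases "1 \<le> norm \<eta>")
      case True
      have "c * norm \<eta> \<le> c * c ^ n" using expand[of \<eta>] Suc.prems \<eta> by simp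
      then have "R z \<le> R \<eta>" using True c by (intro Suc.IH) simp_all
      also have "\<dots> \<le> \<tau> * R \<eta>" using \<tau> nonneg[of \<eta>] by (simp add: mult_le_cancel_right1)
      finally show ?thesis by (simp add: \<eta> RB)
    next
      case False
      then have "norm \<eta> * K \<le> 1 * K" using K(1) by (intro mult_right_mono) simp_all
      with K(2)[of \<eta>] Suc.prems show ?thesis
        by (intro z(2)) (simp add: S_def \<eta>)
    qed
  qed
  show ?thesis
  proof (rule that)
    show "R z > 0" using z(1) by (intro pos) (auto simp: S_def)
    fix \<xi> assume "R \<xi> < R z"
    obtain n where "norm \<xi> < c ^ n" using real_arch_pow[OF c] by blast
    with far[of \<xi> n] \<open>R \<xi> < R z\<close> show "norm \<xi> < 1" by fastforce
  qed
qed

section \<open>Determinants of symmetries\<close>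

lemma abs_det_le:
  fixes M :: "real ^ 'n ^ 'n"
  assumes "\<And>i j. \<bar>M $ i $ j\<bar> \<le> C"
  shows "\<bar>det M\<bar> \<le> fact CARD('n) * C ^ CARD('n)"
proof -
  have "\<bar>det M\<bar> \<le> (\<Sum>p\<in>{p. p permutes (UNIV :: 'n set)}. \<bar>of_int (sign p) * (\<Prod>i\<in>UNIV. M $ i $ p i)\<bar>)"
    unfolding det_def by (rule sum_abs)
  also have "\<dots> \<le> (\<Sum>p\<in>{p. p permutes (UNIV :: 'n set)}. C ^ CARD('n))"
  proof (rule sum_mono)
    fix p :: "'n \<Rightarrow> 'n"
    have "\<bar>of_int (sign p) * (\<Prod>i\<in>UNIV. M $ i $ p i)\<bar> = (\<Prod>i\<in>UNIV. \<bar>M $ i $ p i\<bar>)"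
      by (simp add: abs_mult abs_prod sign_def)
    also have "\<dots> \<le> (\<Prod>i\<in>(UNIV :: 'n set). C)"
      by (intro prod_mono) (simp add: assms)
    finally show "\<bar>of_int (sign p) * (\<Prod>i\<in>UNIV. M $ i $ p i)\<bar> \<le> C ^ CARD('n)" by simp
  qed
  also have "\<dots> = fact CARD('n) * C ^ CARD('n)"
    by (simp add: card_permutations)
  finally show ?thesis .
qed

text \<open>The sublevel set \<open>{R < m}\<close> contains a ball of some radius \<open>d\<close> about the origin and lies in the
  unit ball. Every power of \<open>Q\<close> preserves it, so the entries of all powers are bounded by a
  multiple of \<open>1 / d\<close>; if \<open>\<bar>det Q\<bar>\<close> exceeded \<open>1\<close>, the determinants of the powers would grow
  without bound.\<close>

lemma abs_det_le_1_if_preserves_function: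
  fixes R :: "real ^ 'n \<Rightarrow> real" and Q :: "real ^ 'n ^ 'n"
  assumes cont: "continuous_on UNIV R" and zero: "R 0 = 0"
    and m: "m > 0" "\<And>\<xi>. R \<xi> < m \<Longrightarrow> norm \<xi> < 1"
    and inv: "\<And>\<xi>. R (Q *v \<xi>) = R \<xi>"
  shows "\<bar>det Q\<bar> \<le> 1"
proof (rule ccontr)
  assume "\<not> \<bar>det Q\<bar> \<le> 1"
  have "isCont R 0" using cont by (simp add: continuous_on_eq_continuous_at)
  then obtain d where "d > 0" "\<forall>\<xi>. norm \<xi> < d \<longrightarrow> \<bar>R \<xi>\<bar> < m"
    using m(1) zero by (auto simp: continuous_at_eps_delta dist_norm dest!: spec[of _ m])
  then have d: "d > 0" "\<And>\<xi>. norm \<xi> < d \<Longrightarrow> R \<xi> < m"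
    by (auto simp: abs_less_iff)
  have inv_power: "R (mat_power Q k *v \<xi>) = R \<xi>" for k \<xi>
    by (induction k) (simp_all add: mat_power_def inv flip: matrix_vector_mul_assoc)
  have det_power: "det (mat_power Q k) = det Q ^ k" for k
    by (induction k) (simp_all add: mat_power_def det_mul)
  have entry: "\<bar>mat_power Q k $ i $ j\<bar> \<le> 2 / d" for k i j
  proof -
    let ?\<xi> = "(d / 2) *\<^sub>R axis j 1 :: real ^ 'n"
    have "norm ?\<xi> < d" using d(1) by simp
    then have "norm (mat_power Q k *v ?\<xi>) < 1"
      by (intro m(2)) (simp only: inv_power d(2))
    moreover have "(mat_power Q k *v ?\<xi>) $ i = d / 2 * mat_power Q k $ i $ j"
      by (simp add: matrix_vector_mult_scaleR matrix_vector_mul_component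
        cart_eq_inner_axis[symmetric] matrix_vector_mult_basis column_def)
    ultimately have "\<bar>d / 2 * mat_power Q k $ i $ j\<bar> < 1"
      using component_le_norm_cart[of "mat_power Q k *v ?\<xi>" i] by simp
    then show ?thesis using d(1) by (simp add: abs_mult field_simps)
  qed
  obtain k where "fact CARD('n) * (2 / d) ^ CARD('n) < \<bar>det Q\<bar> ^ k"
    using \<open>\<not> \<bar>det Q\<bar> \<le> 1\<close> real_arch_pow by (metis linorder_not_le)
  moreover have "\<bar>det Q\<bar> ^ k \<le> fact CARD('n) * (2 / d) ^ CARD('n)"
    using abs_det_le[OF entry, of k] by (simp add: det_power power_abs)
  ultimately show False by simp
qed

lemma abs_det_le_if_same_scaling:
  fixes R :: "real ^ 'n \<Rightarrow> real" and A B :: "real ^ 'n ^ 'n"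
  assumes cont: "continuous_on UNIV R"
    and zero: "R 0 = 0" and pos: "\<And>\<xi>. \<xi> \<noteq> 0 \<Longrightarrow> R \<xi> > 0"
    and m: "m > 0" "\<And>\<xi>. R \<xi> < m \<Longrightarrow> norm \<xi> < 1"
    and t: "t > 0" and A: "\<And>\<xi>. R (A *v \<xi>) = t * R \<xi>" and B: "\<And>\<xi>. R (B *v \<xi>) = t * R \<xi>"
  shows "\<bar>det A\<bar> \<le> \<bar>det B\<bar>"
proof -
  have "\<xi> = 0" if "B *v \<xi> = 0" for \<xi>
    using B[of \<xi>] t pos[of \<xi>] zero that by fastforce
  then obtain C where "C ** B = mat 1"
    using matrix_left_invertible_ker by blast
  then have C: "B ** C = mat 1" by (simp add: matrix_left_right_inverse)
  have "R ((C ** A) *v \<xi>) = R \<xi>" for \<xi>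
  proof -
    have "t * R ((C ** A) *v \<xi>) = R ((B ** C) *v (A *v \<xi>))"
      by (simp only: B[symmetric] matrix_vector_mul_assoc matrix_mul_assoc)
    also have "\<dots> = t * R \<xi>" by (simp add: C A)
    finally show ?thesis using t by simp
  qed
  then have "\<bar>det (C ** A)\<bar> \<le> 1"
    using abs_det_le_1_if_preserves_function[OF cont zero m] by blast
  then have "\<bar>det B\<bar> * \<bar>det (C ** A)\<bar> \<le> \<bar>det B\<bar>"
    by (simp add: mult_left_le)
  moreover have "\<bar>det B\<bar> * \<bar>det (C ** A)\<bar> = \<bar>det ((B ** C) ** A)\<bar>"
    by (simp add: det_mul abs_mult)
  ultimately show ?thesis by (simp add: C)
qed

section \<open>The trace as a derivative\<close>

text \<open>In the Leibniz formula only the identity permutation contributes to the first order: any other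
  permutation moves at least two indices, so each term of the product rule keeps an off-diagonal
  entry of the identity matrix as a factor.\<close>

lemma has_derivative_det_at_mat_1:
  fixes M :: "real \<Rightarrow> real ^ 'n ^ 'n"
  assumes M0: "M 0 = mat 1"
    and M': "\<And>i j. ((\<lambda>h. M h $ i $ j) has_real_derivative E $ i $ j) (at 0)"
  shows "((\<lambda>h. det (M h)) has_real_derivative trace E) (at 0)"
proof -
  let ?D = "\<lambda>p. \<Sum>i\<in>UNIV. E $ i $ p i * (\<Prod>j\<in>UNIV - {i}. (mat 1 :: real ^ 'n ^ 'n) $ j $ p j)"
  have "((\<lambda>h. det (M h)) has_real_derivative
      (\<Sum>p\<in>{p. p permutes (UNIV :: 'n set)}. of_int (sign p) * ?D p)) (at 0)"
    unfolding det_def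
  proof (intro DERIV_sum DERIV_cmult)
    fix p :: "'n \<Rightarrow> 'n"
    show "((\<lambda>h. \<Prod>i\<in>UNIV. M h $ i $ p i) has_real_derivative ?D p) (at 0)"
      using has_field_derivative_prod[of UNIV "\<lambda>i h. M h $ i $ p i" "\<lambda>i. E $ i $ p i" 0] M'
      by (simp add: M0)
  qed
  moreover have "(\<Sum>p\<in>{p. p permutes (UNIV :: 'n set)}. of_int (sign p) * ?D p) = trace E"
  proof -
    have "?D p = 0" if p: "p permutes UNIV" "p \<noteq> id" for p :: "'n \<Rightarrow> 'n"
    proof (intro sum.neutral ballI)
      fix i
      obtain k where k: "p k \<noteq> k" using p(2) by (auto simp: fun_eq_iff)
      have "p (p k) \<noteq> p k" using k permutes_inj[OF p(1)] by (auto dest: injD)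
      with k obtain j where "j \<noteq> i" "p j \<noteq> j" by metis
      then have "(\<Prod>j\<in>UNIV - {i}. (mat 1 :: real ^ 'n ^ 'n) $ j $ p j) = 0"
        by (intro prod_zero) (auto simp: mat_def intro!: bexI[of _ j])
      then show "E $ i $ p i * (\<Prod>j\<in>UNIV - {i}. (mat 1 :: real ^ 'n ^ 'n) $ j $ p j) = 0" by simp
    qed
    then have "(\<Sum>p\<in>{p. p permutes (UNIV :: 'n set)}. of_int (sign p) * ?D p)
        = (\<Sum>p\<in>{id}. of_int (sign p) * ?D p)"
      by (intro sum.mono_neutral_right) (auto simp: permutes_id)
    also have "\<dots> = trace E" by (simp add: mat_def trace_def)
    finally show ?thesis .
  qed
  ultimately show ?thesis by simp
qed

lemma mat_power_scaleR: "mat_power (h *\<^sub>R A) k = h ^ k *\<^sub>R mat_power A k"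
  by (induction k) (simp_all add: mat_power_def matrix_scalar_ac flip: scalar_matrix_assoc)

text \<open>The entries of \<open>exp (h E)\<close> are everywhere convergent power series in \<open>h\<close>, so their values and
  derivatives at \<open>0\<close> are the first two coefficients.\<close>

lemma mat_exp_scaleR_component:
  fixes E :: "real ^ 'n ^ 'n"
  shows "mat_exp (h *\<^sub>R E) $ i $ j = (\<Sum>k. mat_power E k $ i $ j / fact k * h ^ k)"
  and summable_mat_exp_component: "summable (\<lambda>k. mat_power E k $ i $ j / fact k * h ^ k)"
proof -
  have lin: "bounded_linear (\<lambda>A :: real ^ 'n ^ 'n. A $ i $ j)"
    using bounded_linear_compose[OF bounded_linear_vec_nth[of j] bounded_linear_vec_nth[of i]]
    by (simp add: o_def)
  have eq: "((1 / fact k) *\<^sub>R mat_power (h *\<^sub>R E) k) $ i $ j = mat_power E k $ i $ j / fact k * h ^ k" for k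
    by (simp add: mat_power_scaleR)
  show "mat_exp (h *\<^sub>R E) $ i $ j = (\<Sum>k. mat_power E k $ i $ j / fact k * h ^ k)"
    using bounded_linear.suminf[OF lin summable_mat_exp[of "h *\<^sub>R E"]] by (simp only: mat_exp_def eq)
  show "summable (\<lambda>k. mat_power E k $ i $ j / fact k * h ^ k)"
    using bounded_linear.summable[OF lin summable_mat_exp[of "h *\<^sub>R E"]] by (simp only: eq)
qed

lemma mat_exp_zero: "mat_exp (0 *\<^sub>R E) = mat 1"
  by (simp only: vec_eq_iff mat_exp_scaleR_component powser_zero) (simp add: mat_power_def)

lemma has_derivative_mat_exp_component:
  "((\<lambda>h. mat_exp (h *\<^sub>R E) $ i $ j) has_real_derivative E $ i $ j) (at 0)"
proof -
  let ?c = "\<lambda>k. mat_power E k $ i $ j / fact k"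
  have "((\<lambda>h. \<Sum>k. ?c k * h ^ k) has_real_derivative (\<Sum>k. diffs ?c k * 0 ^ k)) (at 0)"
    by (rule termdiffs_strong_converges_everywhere) (rule summable_mat_exp_component)
  moreover have "(\<Sum>k. diffs ?c k * 0 ^ k) = E $ i $ j"
    by (simp only: powser_zero) (simp add: diffs_def mat_power_def)
  ultimately show ?thesis by (simp only: mat_exp_scaleR_component)
qed

lemma has_derivative_det_mat_exp:
  "((\<lambda>h. det (mat_exp (h *\<^sub>R E))) has_real_derivative trace E) (at 0)"
  by (rule has_derivative_det_at_mat_1[OF mat_exp_zero has_derivative_mat_exp_component])

section \<open>Independence of the trace\<close>

theorem corollary2p4:
  fixes P :: "real ^ 'n \<Rightarrow> complex" and E E' :: "real ^ 'n ^ 'n"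
  assumes "polynomial_function P"
    and "positive_homogeneous P"
    and "E \<in> Exp_set P" and "E' \<in> Exp_set P"
  shows "trace E = trace E'"
proof -
  define R where "R \<xi> = Re (P \<xi>)" for \<xi>
  have scale: "R (mat_powr t F *v \<xi>) = t * R \<xi>" if "F \<in> Exp_set P" "t > 0" for F t \<xi>
    using that by (simp add: R_def Exp_set_def flip: scaleR_conv_of_real) (metis scaleR_complex.sel(1))
  have cont: "continuous_on UNIV R"
    using assms(2) unfolding R_def positive_homogeneous_def by (intro continuous_intros) simp
  have zero: "R 0 = 0" using scale[OF assms(3), of 2 0] by simp
  have pos: "R \<xi> > 0" if "\<xi> \<noteq> 0" for \<xi>
    using assms(2) that unfolding R_def positive_homogeneous_def by (metis order_le_less)
  obtain m where m: "m > 0" "\<And>\<xi>. R \<xi> < m \<Longrightarrow> norm \<xi> < 1"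
    using positive_definite_sublevel_bounded[OF cont zero pos, of "\<lambda>t. mat_powr t E"]
      scale[OF assms(3)] by metis
  have le: "\<bar>det (mat_exp (h *\<^sub>R F))\<bar> \<le> \<bar>det (mat_exp (h *\<^sub>R G))\<bar>"
    if "F \<in> Exp_set P" "G \<in> Exp_set P" for F G h
    using abs_det_le_if_same_scaling[OF cont zero pos m, of "exp h" "mat_powr (exp h) F" "mat_powr (exp h) G"]
      scale[OF that(1), of "exp h"] scale[OF that(2), of "exp h"] by (simp add: mat_powr_def)
  \<comment> \<open>Equality of the absolute values becomes equality of the squares, which are smooth
    in \<open>h\<close>.\<close>
  have square_eq: "det (mat_exp (h *\<^sub>R E)) ^ 2 = det (mat_exp (h *\<^sub>R E')) ^ 2" for h
    using le[OF assms(3,4)] le[OF assms(4,3)] by (simp add: abs_le_square_iff antisym)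
  have square_deriv: "((\<lambda>h. det (mat_exp (h *\<^sub>R F)) ^ 2) has_real_derivative 2 * trace F) (at 0)" for F :: "real ^ 'n ^ 'n"
    using DERIV_power[OF has_derivative_det_mat_exp[of F], of 2] by (simp add: mat_exp_zero[simplified])
  have "2 * trace E = 2 * trace E'"
    using DERIV_unique square_deriv[of E] square_deriv[of E'] by (simp only: square_eq)
  then show ?thesis by simp
qed

end
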